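(* Let $n\ge1$ and $m\ge1$. The set of Pak–Stanley labels of the regions of the $n$-dimensional $m$-Catalan arrangement is exactly the set of $m$-Catalan functions of dimension $n$, and the Pak–Stanley labeling is a bijection from the set of regions onto this set.
   Context: $\mathbb N=\{1,2,3,\dots\}$, $[n]=\{1,\dots,n\}$, $\mathbf 1=(1,\dots,1)$. The $n$-dimensional $m$-Catalan arrangement consists of the hyperplanes $\{x\in\mathbb R^n: x_i-x_j=a\}$ for $1\le i<j\le n$ and integers $a\in[-m,m]$; its regions are the connected components of the complement of their union. Let $R_0$ be the region containing the points with $x_1>\dots>x_n$ and $x_1-x_n<1$. The Pak–Stanley label of a region $R$ is $\mathbf 1+\sum_H e_{c(H)}$, summed over the hyperplanes $H$ separating $R$ from $R_0$, where for $H=\{x_i-x_j=a\}$ ($i<j$), $c(H)=j$ if $a>0$ and $c(H)=i$ if $a\le0$ ($e_k$ the standard basis vector). For $\mathbf a\in\mathbb N^n$ and an integer $p$, the $p$-center $Z_p(\mathbf a)$ is the largest subset $X=\{x_1,\dots,x_q\}$ of $[n]$ with $x_q<\dots<x_1$ such that $a_{x_j}\le p+j$ for every $j\in[q]$; $z_p(\mathbf a)=|Z_p(\mathbf a)|$. An $m$-Catalan function of dimension $n$ is $\mathbf a\in\mathbb N^n$ such that $z_{(i-1)m}(\mathbf a)\ge i$ for every $i\in[n]$. *)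

theory Defs
  imports "HOL-Analysis.Analysis"
begin

(* Points of R^n are the functions in {1..n} \<rightarrow>\<^sub>E UNIV, with the product topology. *)

definition hyperplane :: "nat \<Rightarrow> nat \<times> nat \<times> int \<Rightarrow> (nat \<Rightarrow> real) set" where
  "hyperplane n = (\<lambda>(i, j, a). {x \<in> {1..n} \<rightarrow>\<^sub>E UNIV. x i - x j = of_int a})"

definition catalan_triples :: "nat \<Rightarrow> nat \<Rightarrow> (nat \<times> nat \<times> int) set" where
  "catalan_triples n m =
     {(i, j, a). 1 \<le> i \<and> i < j \<and> j \<le> n \<and> - int m \<le> a \<and> a \<le> int m}"

(* Hence a sum over the hyperplanes of the arrangement is a sum over its triples. *)
lemma inj_on_hyperplane: "inj_on (hyperplane n) (catalan_triples n m)"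
proof (rule inj_onI)
  fix H H'
  assume H: "H \<in> catalan_triples n m" "H' \<in> catalan_triples n m"
    "hyperplane n H = hyperplane n H'"
  obtain i j a i' j' a' where HH': "H = (i, j, a)" "H' = (i', j', a')"
    by (metis surj_pair)
  note t = H(1,2)[unfolded HH'] and eq = H(3)[unfolded HH']
  define x :: "real \<Rightarrow> nat \<Rightarrow> real" where
    "x = (\<lambda>s. \<lambda>k\<in>{1..n}. if k = j then 0 else if k = i then of_int a else s * real k)"
  have "x s \<in> hyperplane n (i, j, a)" for s
    using t by (auto simp: hyperplane_def catalan_triples_def x_def)
  then have "x s \<in> hyperplane n (i', j', a')" for s
    using eq by simp
  then have h: "x s i' - x s j' = of_int a'" for s
    by (auto simp: hyperplane_def)
  define y :: "nat \<Rightarrow> real" where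
    "y = (\<lambda>k\<in>{1..n}. if k = j then 1 else if k = i then of_int a + 1 else 0)"
  have "y \<in> hyperplane n (i, j, a)"
    using t by (auto simp: hyperplane_def catalan_triples_def y_def)
  then have "y \<in> hyperplane n (i', j', a')"
    using eq by simp
  then have "y i' - y j' = of_int a'"
    by (auto simp: hyperplane_def)
  then show "H = H'"
    using HH' t h[of 0] h[of 1]
    by (auto simp: catalan_triples_def x_def y_def split: if_splits)
qed

definition catalan_regions :: "nat \<Rightarrow> nat \<Rightarrow> (nat \<Rightarrow> real) set set" where
  "catalan_regions n m =
     connected_components_of
       (subtopology (powertop_real {1..n})
          (({1..n} \<rightarrow>\<^sub>E UNIV) - (\<Union>H \<in> catalan_triples n m. hyperplane n H)))"

definition base_region :: "nat \<Rightarrow> nat \<Rightarrow> (nat \<Rightarrow> real) set" where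
  "base_region n m =
     (THE R. R \<in> catalan_regions n m \<and>
        {x \<in> {1..n} \<rightarrow>\<^sub>E UNIV. strict_antimono_on {1..n} x \<and> x 1 - x n < 1} \<subseteq> R)"

definition separates ::
  "nat \<times> nat \<times> int \<Rightarrow> (nat \<Rightarrow> real) set \<Rightarrow> (nat \<Rightarrow> real) set \<Rightarrow> bool" where
  "separates = (\<lambda>(i, j, a) R S.
     R \<subseteq> {x. x i - x j < of_int a} \<and> S \<subseteq> {x. x i - x j > of_int a} \<or>
     R \<subseteq> {x. x i - x j > of_int a} \<and> S \<subseteq> {x. x i - x j < of_int a})"

definition hyperplane_coord :: "nat \<times> nat \<times> int \<Rightarrow> nat" where
  "hyperplane_coord = (\<lambda>(i, j, a). if a > 0 then j else i)"

definition pak_stanley_label :: "nat \<Rightarrow> nat \<Rightarrow> (nat \<Rightarrow> real) set \<Rightarrow> nat \<Rightarrow> nat" where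
  "pak_stanley_label n m R =
     (\<lambda>k\<in>{1..n}. 1 + (\<Sum>H \<in> {H \<in> catalan_triples n m. separates H R (base_region n m)}.
        of_bool (k = hyperplane_coord H)))"

definition center_admissible :: "nat \<Rightarrow> int \<Rightarrow> (nat \<Rightarrow> nat) \<Rightarrow> nat set \<Rightarrow> bool" where
  "center_admissible n p a X \<longleftrightarrow> X \<subseteq> {1..n} \<and>
     (\<exists>q x. X = x ` {1..q} \<and> strict_antimono_on {1..q} x \<and>
        (\<forall>j\<in>{1..q}. int (a (x j)) \<le> p + int j))"

(* Admissible sets are closed under union: an element keeps or increases its position j
   (counted from the largest element) when further elements are added. So there is a greatest
   one with respect to inclusion, and it is also the unique one of maximal cardinality. *)
definition center :: "nat \<Rightarrow> int \<Rightarrow> (nat \<Rightarrow> nat) \<Rightarrow> nat set" where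
  "center n p a = (GREATEST X. center_admissible n p a X)"

definition catalan_functions :: "nat \<Rightarrow> nat \<Rightarrow> (nat \<Rightarrow> nat) set" where
  "catalan_functions n m =
     {a \<in> {1..n} \<rightarrow>\<^sub>E {1..}. \<forall>i\<in>{1..n}. card (center n ((int i - 1) * int m) a) \<ge> i}"

end

theory Submission
  imports Defs
begin

text \<open>
  For a point x of a region, the label at k is 1 plus the number of pairs (i, b) with
  1 \<le> b \<le> m and x_k + b < x_i, plus the number of j > k with x_j > x_k; so it depends only
  on the coordinates larger than x_k. Let T be the set of the s largest coordinates. For a next
  coordinate k, the number c_k = a_k - 1 - #{j \<in> T. j > k} is the number of shifted points x_i - b
  (i \<in> T, 1 \<le> b \<le> m) above x_k, and the next coordinate is the one with
  lexicographically least (c_k, k). This reconstructs the region from its label. Started from an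
  arbitrary label a, the greedy reconstruction can place its next coordinate as long as
  c_k \<le> m s for some k outside T, and this is what a center of size at least s + 1 provides:
  its largest element outside T is such a k. Conversely, the i largest coordinates of a point form
  an admissible set.
\<close>

section \<open>Generic points, their labels and their largest coordinates\<close>

definition generic :: "nat \<Rightarrow> nat set \<Rightarrow> (nat \<Rightarrow> real) \<Rightarrow> bool" where
  "generic m T x \<longleftrightarrow> (\<forall>i\<in>T. \<forall>j\<in>T. i \<noteq> j \<longrightarrow> (\<forall>b\<le>m. x i \<noteq> x j + real b))"

text \<open>The height \<open>v\<close> is a free real, so that a coordinate not yet placed can be
  tested; pairs rather than reals are collected, so that the sets of two points can be
  compared.\<close>

definition shifts :: "nat \<Rightarrow> nat set \<Rightarrow> (nat \<Rightarrow> real) \<Rightarrow> real \<Rightarrow> (nat \<times> nat) set" where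
  "shifts m T x v = {(i, b). i \<in> T \<and> 1 \<le> b \<and> b \<le> m \<and> v + real b < x i}"

text \<open>The shift 0 is counted separately, and only for \<open>k < j\<close>, because the
  hyperplane \<open>x_i - x_j = 0\<close> is charged to its smaller index.\<close>

definition point_label :: "nat \<Rightarrow> nat set \<Rightarrow> (nat \<Rightarrow> real) \<Rightarrow> nat \<Rightarrow> nat" where
  "point_label m T x k = 1 + card (shifts m T x (x k)) + card {j \<in> T. k < j \<and> x k < x j}"

definition upper_part :: "nat set \<Rightarrow> (nat \<Rightarrow> real) \<Rightarrow> nat set \<Rightarrow> bool" where
  "upper_part N x T \<longleftrightarrow> T \<subseteq> N \<and> (\<forall>i\<in>T. \<forall>j\<in>N - T. x j < x i)"

definition same_order :: "nat \<Rightarrow> nat set \<Rightarrow> (nat \<Rightarrow> real) \<Rightarrow> (nat \<Rightarrow> real) \<Rightarrow> bool" where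
  "same_order m T x y \<longleftrightarrow>
     (\<forall>i\<in>T. \<forall>j\<in>T. i \<noteq> j \<longrightarrow> (\<forall>b\<le>m. x j + real b < x i \<longleftrightarrow> y j + real b < y i))"

lemma shifts_subset: "shifts m T x v \<subseteq> T \<times> {1..m}"
  by (auto simp: shifts_def)

lemma finite_shifts: "finite T \<Longrightarrow> finite (shifts m T x v)"
  by (rule finite_subset[OF shifts_subset]) simp

lemma generic_inj_on: "generic m T x \<Longrightarrow> inj_on x T"
  unfolding generic_def inj_on_def by (metis add.right_neutral of_nat_0 zero_le)

text \<open>Everything counted in the label at \<open>k\<close> exceeds \<open>x k\<close> and hence
  lies in every upper part containing \<open>k\<close>.\<close>

lemma point_label_upper_part:
  assumes "upper_part N x T" "k \<in> T"
  shows "point_label m N x k = point_label m T x k"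
proof -
  have above: "i \<in> T" if "i \<in> N" "x k < x i" for i
    using assms that unfolding upper_part_def by (metis DiffI less_asym)
  then have "i \<in> T" if "i \<in> N" "x k + real b < x i" for i b
    using that by (smt (verit) of_nat_0_le_iff)
  then have "shifts m N x (x k) = shifts m T x (x k)"
    using assms unfolding shifts_def upper_part_def by auto
  moreover have "{j \<in> N. k < j \<and> x k < x j} = {j \<in> T. k < j \<and> x k < x j}"
    using assms above unfolding upper_part_def by auto
  ultimately show ?thesis by (simp add: point_label_def)
qed

lemma upper_part_insert:
  assumes "inj_on x N" "upper_part N x T" "k \<in> N - T" "\<forall>j\<in>N - T. x j \<le> x k"
  shows "upper_part N x (insert k T)"
  using assms unfolding upper_part_def inj_on_def
  by (smt (verit) Diff_iff insert_iff insert_subset)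

lemma obtain_top:
  fixes x :: "nat \<Rightarrow> real"
  assumes "finite N" "T \<subseteq> N" "card T < card N"
  obtains k where "k \<in> N - T" "\<forall>j\<in>N - T. x j \<le> x k"
proof -
  have ne: "N - T \<noteq> {}" using assms by (metis Diff_eq_empty_iff order_antisym less_irrefl)
  have fin: "finite (x ` (N - T))" using assms by simp
  have "Max (x ` (N - T)) \<in> x ` (N - T)" using ne fin by (intro Max_in) auto
  then obtain k where "k \<in> N - T" "x k = Max (x ` (N - T))" by auto
  then show thesis using that[of k] fin by (metis Max_ge imageI)
qed

lemma ex_upper_part:
  assumes "finite N" "inj_on x N" "s \<le> card N"
  shows "\<exists>T. upper_part N x T \<and> card T = s"
  using assms(3)
proof (induction s)
  case 0
  show ?case by (rule exI[of _ "{}"]) (simp add: upper_part_def)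
next
  case (Suc s)
  then obtain T where T: "upper_part N x T" "card T = s" by auto
  then have sub: "T \<subseteq> N" by (simp add: upper_part_def)
  then obtain k where k: "k \<in> N - T" "\<forall>j\<in>N - T. x j \<le> x k"
    using obtain_top[OF assms(1)] T Suc by (metis Suc_le_lessD)
  have "card (insert k T) = Suc s"
    using k T sub assms(1) by (metis Diff_iff card_insert_disjoint finite_subset)
  then show ?case using upper_part_insert[OF assms(2) T(1) k] by blast
qed

section \<open>Labels determine the order\<close>

text \<open>The coordinates above \<open>x k\<close> are exactly those of \<open>T\<close>, so
  inversions are counted by index alone. Once \<open>T\<close> is known, the label reveals the
  number of shifts above \<open>x k\<close>.\<close>

lemma point_label_next:
  assumes "finite N" "inj_on x N" "upper_part N x T" "k \<in> N - T" "\<forall>j\<in>N - T. x j \<le> x k"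
  shows "point_label m N x k = 1 + card (shifts m T x (x k)) + card {j \<in> T. k < j}"
proof -
  have u: "upper_part N x (insert k T)" using upper_part_insert assms by blast
  have "shifts m (insert k T) x (x k) = shifts m T x (x k)" by (auto simp: shifts_def)
  moreover have "{j \<in> insert k T. k < j \<and> x k < x j} = {j \<in> T. k < j}"
    using assms unfolding upper_part_def by auto
  ultimately show ?thesis
    using point_label_upper_part[OF u, of k m] by (simp add: point_label_def)
qed

text \<open>All shifts above \<open>x k\<close> are also above the lower \<open>x l\<close>, and
  \<open>k\<close> is a further inversion if \<open>l < k\<close>. This is the lexicographic
  minimality of \<open>k\<close> outside \<open>T\<close>.\<close>

lemma point_label_later:
  assumes "finite N" "inj_on x N" "upper_part N x T" "k \<in> N - T" "\<forall>j\<in>N - T. x j \<le> x k"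
    and "l \<in> N - T" "l \<noteq> k"
  shows "point_label m N x l \<ge> 1 + card (shifts m T x (x k)) + card {j \<in> T. l < j} + of_bool (l < k)"
proof -
  have lk: "x l < x k" using assms unfolding inj_on_def by (metis Diff_iff order_less_le)
  have TN: "T \<subseteq> N" and fT: "finite T"
    using assms unfolding upper_part_def by (auto intro: finite_subset)
  have a: "card (shifts m T x (x k)) \<le> card (shifts m N x (x l))"
    using lk TN by (intro card_mono finite_shifts assms) (auto simp: shifts_def)
  have "card {j \<in> T. l < j} + of_bool (l < k) = card ({j \<in> T. l < j} \<union> (if l < k then {k} else {}))"
    using assms(4) fT by auto
  also have "\<dots> \<le> card {j \<in> N. l < j \<and> x l < x j}"
    using assms lk TN unfolding upper_part_def
    by (intro card_mono) (auto split: if_splits)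
  finally show ?thesis using a by (simp add: point_label_def)
qed

text \<open>Both sets are up-closed for the order of the points x_i - b, which is determined by
  \<^const>\<open>same_order\<close>; hence they are comparable.\<close>
lemma shifts_eqI:
  assumes "finite T" "same_order m T x y" "card (shifts m T x v) = card (shifts m T y w)"
  shows "shifts m T x v = shifts m T y w"
proof -
  have "shifts m T x v \<subseteq> shifts m T y w \<or> shifts m T y w \<subseteq> shifts m T x v"
  proof (rule ccontr)
    assume "\<not> ?thesis"
    then obtain i b i' b' where h:
      "(i, b) \<in> shifts m T x v" "(i, b) \<notin> shifts m T y w"
      "(i', b') \<in> shifts m T y w" "(i', b') \<notin> shifts m T x v" by fast
    then have mem: "i \<in> T" "i' \<in> T" "b \<le> m" "b' \<le> m"
      and x: "x i' + real b < x i + real b'" and y: "y i + real b' < y i' + real b"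
      by (auto simp: shifts_def)
    have so: "x j + real d < x i \<longleftrightarrow> y j + real d < y i"
      if "i \<in> T" "j \<in> T" "i \<noteq> j" "d \<le> m" for i j d
      using assms(2) that by (auto simp: same_order_def)
    have le: "b - b' \<le> m" "b' - b \<le> m" using mem by auto
    consider "i = i'" | "i \<noteq> i'" "b' \<le> b" | "i \<noteq> i'" "b \<le> b'" by linarith
    then show False
    proof cases
      case 1 then show False using x y by simp
    next
      case 2
      then show False using so[of i i' "b - b'"] mem le x y by (auto simp: of_nat_diff)
    next
      case 3
      then show False using so[of i' i "b' - b"] mem le x y by (auto simp: of_nat_diff)
    qed
  qed
  then show ?thesis
    using assms finite_shifts by (metis card_subset_eq)
qed

text \<open>Induction on the size of a common upper part: equal labels force the same next index and
  then the same position among the shifted points.\<close>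

lemma point_label_inj:
  assumes "finite N" "generic m N x" "generic m N y"
    and lab: "\<And>k. k \<in> N \<Longrightarrow> point_label m N x k = point_label m N y k"
  shows "same_order m N x y"
proof -
  have inj: "inj_on x N" "inj_on y N" using assms generic_inj_on by auto
  have "\<exists>T. upper_part N x T \<and> upper_part N y T \<and> card T = s \<and> same_order m T x y"
    if "s \<le> card N" for s
    using that
  proof (induction s)
    case 0
    show ?case by (rule exI[of _ "{}"]) (simp add: upper_part_def same_order_def)
  next
    case (Suc s)
    then obtain T where T: "upper_part N x T" "upper_part N y T" "card T = s" "same_order m T x y"
      by auto
    then have sub: "T \<subseteq> N" and fT: "finite T" and less: "card T < card N"
      using assms(1) Suc.prems unfolding upper_part_def by (auto intro: finite_subset)
    obtain k where k: "k \<in> N - T" "\<forall>j\<in>N - T. x j \<le> x k"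
      using obtain_top[OF assms(1) sub less] by metis
    obtain l where l: "l \<in> N - T" "\<forall>j\<in>N - T. y j \<le> y l"
      using obtain_top[OF assms(1) sub less] by metis
    note k1 = point_label_next[OF assms(1) inj(1) T(1) k, of m]
    note l1 = point_label_next[OF assms(1) inj(2) T(2) l, of m]
    \<comment> \<open>Otherwise each of \<open>k\<close> and \<open>l\<close> precedes the other
      lexicographically; the two inequalities add up to a contradiction because exactly one
      \<open>of_bool\<close> is 1.\<close>
    have kl: "k = l"
    proof (rule ccontr)
      assume "k \<noteq> l"
      then have "point_label m N x l \<ge>
            1 + card (shifts m T x (x k)) + card {j \<in> T. l < j} + of_bool (l < k)"
          "point_label m N y k \<ge>
            1 + card (shifts m T y (y l)) + card {j \<in> T. k < j} + of_bool (k < l)"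
        using point_label_later[OF assms(1) inj(1) T(1) k l(1), of m]
          point_label_later[OF assms(1) inj(2) T(2) l k(1), of m] by auto
      moreover have "of_bool (l < k) + of_bool (k < l) = (1 :: nat)" using \<open>k \<noteq> l\<close> by auto
      ultimately show False
        using k1 l1 lab[of k] lab[of l] k(1) l(1) by auto
    qed
    have "card (shifts m T x (x k)) = card (shifts m T y (y k))"
      using k1 l1 lab[of k] k(1) kl by simp
    then have eq: "shifts m T x (x k) = shifts m T y (y k)"
      using shifts_eqI fT T by blast
    \<comment> \<open>Shift 0 is not recorded in \<open>shifts\<close>; for it both sides hold, as
      \<open>k\<close> lies below \<open>T\<close> in both points.\<close>
    have above: "x k + real b < x i \<longleftrightarrow> y k + real b < y i" if "i \<in> T" "b \<le> m" for i b
    proof (cases "b = 0")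
      case True
      then show ?thesis using T k l kl that unfolding upper_part_def by auto
    next
      case False
      then have "(i, b) \<in> shifts m T x (x k) \<longleftrightarrow> (i, b) \<in> shifts m T y (y k)" using eq by simp
      then show ?thesis using False that by (auto simp: shifts_def)
    qed
    have below: "\<not> x i + real b < x k" "\<not> y i + real b < y k" if "i \<in> T" for i b
    proof -
      have "x k < x i" "y k < y i" using T k l kl that unfolding upper_part_def by auto
      then show "\<not> x i + real b < x k" "\<not> y i + real b < y k" by (auto simp: not_less)
    qed
    have "same_order m (insert k T) x y"
      using T(4) above below unfolding same_order_def by auto
    moreover have "card (insert k T) = Suc s"
      using k T(3) fT by simp
    ultimately show ?case
      using upper_part_insert[OF inj(1) T(1) k] upper_part_insert[OF inj(2) T(2)] l kl by blast
  qed
  from this[of "card N"] show ?thesis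
    using assms(1) unfolding upper_part_def by (metis card_subset_eq le_refl)
qed

section \<open>Centers\<close>

lemma card_above_strict_antimono:
  fixes x :: "nat \<Rightarrow> nat"
  assumes "strict_antimono_on {1..q} x" "j \<in> {1..q}"
  shows "card {k \<in> x ` {1..q}. x j < k} = j - 1"
proof -
  have less: "x i' < x i" if "i < i'" "i \<in> {1..q}" "i' \<in> {1..q}" for i i'
    using assms(1) that unfolding monotone_on_def by blast
  have iff: "x j < x i \<longleftrightarrow> i < j" if "i \<in> {1..q}" for i
    using less[of i j] less[of j i] that assms(2) by (metis less_asym linorder_neqE_nat)
  have "{k \<in> x ` {1..q}. x j < k} = x ` {1..<j}"
    using iff assms(2) by auto
  moreover have "inj_on x {1..<j}"
    using less assms(2) by (intro linorder_inj_onI) (auto, metis Suc_leI less_irrefl order.trans less_imp_le_nat)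
  ultimately show ?thesis by (simp add: card_image)
qed

lemma ex_strict_antimono_enumeration:
  assumes "finite (X :: nat set)"
  shows "\<exists>q x. X = x ` {1..q :: nat} \<and> strict_antimono_on {1..q} x"
proof -
  define l where "l = rev (sorted_list_of_set X)"
  have l: "sorted_wrt (>) l" "set l = X"
    using assms by (simp_all add: l_def sorted_wrt_rev)
  have "X = (\<lambda>j. l ! (j - 1)) ` {1..length l}"
  proof -
    have "X = (\<lambda>j. l ! j) ` {0..<length l}"
      using l(2) nth_image[of "length l" l] by (simp add: atLeast0LessThan)
    also have "{0..<length l} = (\<lambda>j. j - 1) ` {1..length l}"
      by (auto simp: image_iff intro!: bexI[of _ "Suc _"])
    finally show ?thesis by (simp add: image_image)
  qed
  moreover have "strict_antimono_on {1..length l} (\<lambda>j. l ! (j - 1))"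
    using l(1) unfolding monotone_on_def sorted_wrt_iff_nth_less by auto
  ultimately show ?thesis by blast
qed

text \<open>The position of \<open>k\<close> counted from the top is 1 plus the number of larger
  elements, which eliminates the enumeration.\<close>

lemma center_admissible_iff:
  "center_admissible n p a X \<longleftrightarrow>
     X \<subseteq> {1..n} \<and> (\<forall>k\<in>X. int (a k) \<le> p + 1 + int (card {j \<in> X. k < j}))"
proof -
  have *: "(\<forall>j\<in>{1..q}. int (a (x j)) \<le> p + int j) \<longleftrightarrow>
      (\<forall>k\<in>X. int (a k) \<le> p + 1 + int (card {j \<in> X. k < j}))"
    if "X = x ` {1..q}" "strict_antimono_on {1..q} x" for q x
  proof -
    have "(\<forall>k\<in>X. int (a k) \<le> p + 1 + int (card {j \<in> X. k < j})) \<longleftrightarrow>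
      (\<forall>j\<in>{1..q}. int (a (x j)) \<le> p + 1 + int (card {k \<in> x ` {1..q}. x j < k}))"
      using that(1) by blast
    also have "\<dots> \<longleftrightarrow> (\<forall>j\<in>{1..q}. int (a (x j)) \<le> p + int j)"
      by (rule ball_cong) (use card_above_strict_antimono[OF that(2)] in auto)
    finally show ?thesis by simp
  qed
  show ?thesis
  proof (cases "X \<subseteq> {1..n}")
    case True
    then obtain q :: nat and x where "X = x ` {1..q}" "strict_antimono_on {1..q} x"
      using ex_strict_antimono_enumeration finite_subset finite_atLeastAtMost by metis
    then show ?thesis using * unfolding center_admissible_def by blast
  qed (simp add: center_admissible_def)
qed

text \<open>In a union every element keeps at least as many larger elements, so the union of all
  admissible sets is admissible and attains \<open>GREATEST\<close>.\<close>

lemma center_greatest: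
  shows "center_admissible n p a (center n p a)"
    and "center_admissible n p a X \<Longrightarrow> X \<subseteq> center n p a"
proof -
  let ?U = "\<Union>{X. center_admissible n p a X}"
  have U: "center_admissible n p a ?U"
  proof -
    have "int (a k) \<le> p + 1 + int (card {j \<in> ?U. k < j})"
      if "center_admissible n p a X" "k \<in> X" for X k
    proof -
      have "card {j \<in> X. k < j} \<le> card {j \<in> ?U. k < j}"
        using that
        by (intro card_mono finite_subset[of "{j \<in> ?U. k < j}" "{1..n}"])
          (auto simp: center_admissible_def)
      then show ?thesis
        using that unfolding center_admissible_iff by fastforce
    qed
    moreover have "?U \<subseteq> {1..n}" unfolding center_admissible_def by blast
    ultimately show ?thesis unfolding center_admissible_iff[of _ _ _ ?U] by blast
  qed
  then have "center n p a = ?U"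
    unfolding center_def by (intro Greatest_equality) auto
  then show "center_admissible n p a (center n p a)"
    and "center_admissible n p a X \<Longrightarrow> X \<subseteq> center n p a"
    using U by auto
qed

lemma card_center_ge_iff:
  "i \<le> card (center n p a) \<longleftrightarrow> (\<exists>X. center_admissible n p a X \<and> i \<le> card X)"
proof -
  have "finite (center n p a)"
    using center_greatest(1) unfolding center_admissible_def by (metis finite_atLeastAtMost finite_subset)
  then show ?thesis
    using center_greatest by (meson card_mono le_trans)
qed

text \<open>With \<open>T\<close> the \<open>i\<close> largest coordinates, each
  \<open>k \<in> T\<close> has at most \<open>m\<close> shifts of each of the \<open>i - 1\<close>
  others above it; hence the parameter \<open>(i - 1) * m\<close>.\<close>

lemma point_label_admissible:
  assumes "generic m {1..n} x" "i \<in> {1..n}" "\<And>k. k \<in> {1..n} \<Longrightarrow> a k = point_label m {1..n} x k"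
  shows "i \<le> card (center n ((int i - 1) * int m) a)"
proof -
  obtain T where T: "upper_part {1..n} x T" "card T = i"
    using ex_upper_part[OF _ generic_inj_on[OF assms(1)]] assms(2) by fastforce
  have sub: "T \<subseteq> {1..n}" and fT: "finite T"
    using T by (auto simp: upper_part_def intro: finite_subset)
  have "int (a k) \<le> (int i - 1) * int m + 1 + int (card {j \<in> T. k < j})" if "k \<in> T" for k
  proof -
    have "shifts m T x (x k) \<subseteq> (T - {k}) \<times> {1..m}" by (auto simp: shifts_def)
    then have "card (shifts m T x (x k)) \<le> card ((T - {k}) \<times> {1..m})"
      using fT by (intro card_mono) auto
    also have "\<dots> = (i - 1) * m" using that T fT by (simp add: card_cartesian_product)
    finally have "int (card (shifts m T x (x k))) \<le> int ((i - 1) * m)" by linarith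
    also have "\<dots> = (int i - 1) * int m" using assms(2) by (simp add: of_nat_diff)
    finally have 1: "int (card (shifts m T x (x k))) \<le> (int i - 1) * int m" .
    have "card {j \<in> T. k < j \<and> x k < x j} \<le> card {j \<in> T. k < j}"
      using fT by (intro card_mono) auto
    moreover have "a k = point_label m T x k"
      using assms(3) point_label_upper_part[OF T(1) that] that sub by (metis subsetD)
    ultimately show ?thesis using 1 by (simp add: point_label_def)
  qed
  then show ?thesis
    using sub T unfolding card_center_ge_iff center_admissible_iff by blast
qed

section \<open>Every Catalan function is a label\<close>

text \<open>Start above all of \<open>P\<close> and move \<open>v\<close> down past one point at a
  time; each passage raises the count by one.\<close>

lemma ex_card_greater_eq:
  fixes P :: "real set"
  assumes "finite P" "c \<le> card P"
  shows "\<exists>v. v \<notin> P \<and> card {p \<in> P. v < p} = c"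
  using assms(2)
proof (induction c)
  case 0
  \<comment> \<open>Inserting 0 keeps \<open>Max\<close> meaningful for empty
    \<open>P\<close>.\<close>
  have "p < Max (insert 0 P) + 1" if "p \<in> P" for p
    using assms(1) that by (smt (verit) Max_ge finite_insert insert_iff)
  then have "Max (insert 0 P) + 1 \<notin> P \<and> {p \<in> P. Max (insert 0 P) + 1 < p} = {}" by force
  then show ?case by (metis card.empty)
next
  case (Suc c)
  then obtain v where v: "v \<notin> P" "card {p \<in> P. v < p} = c" by auto
  define q where "q = Max {p \<in> P. p < v}"
  have "{p \<in> P. p < v} \<noteq> {}"
  proof
    assume "{p \<in> P. p < v} = {}"
    then have "{p \<in> P. v < p} = P" using v(1) by (auto, metis linorder_neqE)
    then show False using v Suc by simp
  qed
  then have q: "q \<in> P" "q < v" "\<And>p. p \<in> P \<Longrightarrow> p < v \<Longrightarrow> p \<le> q"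
    using Max_in[of "{p \<in> P. p < v}"] Max_ge[of "{p \<in> P. p < v}"] assms(1) by (auto simp: q_def)
  \<comment> \<open>\<open>r\<close> lies below \<open>q\<close> and bounds all points of
    \<open>P\<close> below \<open>q\<close>; \<open>q - 1\<close> covers the case that there are
    none. So a height between \<open>r\<close> and \<open>q\<close> has passed \<open>q\<close> and
    nothing further.\<close>
  define r where "r = Max (insert (q - 1) {p \<in> P. p < q})"
  have "r \<in> insert (q - 1) {p \<in> P. p < q}"
    unfolding r_def using assms(1) by (intro Max_in) auto
  then have r: "r < q" "\<And>p. p \<in> P \<Longrightarrow> p < q \<Longrightarrow> p \<le> r"
    using assms(1) by (auto simp: r_def)
  define w where "w = (r + q) / 2"
  have w: "r < w" "w < q" using r by (auto simp: w_def)
  have "w \<notin> P" using r(2) w by force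
  moreover have "{p \<in> P. w < p} = insert q {p \<in> P. v < p}"
    using w q v(1) r(2) by (force simp: not_less order_less_le)
  then have "card {p \<in> P. w < p} = Suc c" using q v assms(1) by simp
  ultimately show ?case by blast
qed

text \<open>Move down until exactly \<open>c\<close> shifted points are above. As no placed
  coordinate has more than \<open>c\<close> of them above it, this can be done below all of
  \<open>T\<close>.\<close>

lemma ex_point_below:
  assumes "finite T" "generic m T x" "c \<le> m * card T"
    and "\<And>t. t \<in> T \<Longrightarrow> card (shifts m T x (x t)) \<le> c"
  obtains v where "\<And>t. t \<in> T \<Longrightarrow> v < x t" "\<And>t b. t \<in> T \<Longrightarrow> b \<le> m \<Longrightarrow> x t \<noteq> v + real b"
    "card (shifts m T x v) = c"
proof -
  define f where "f = (\<lambda>(i, b). x i - real b)"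
  \<comment> \<open>Including the shifts b = 0 forces the point with c + card T points above it below all of T.\<close>
  define P where "P = f ` (T \<times> {0..m})"
  \<comment> \<open>Genericity makes the reals \<open>x i - b\<close> distinct, so counting them
    amounts to counting pairs.\<close>
  have inj: "inj_on f (T \<times> {0..m})"
  proof (rule inj_onI, clarify)
    fix i b i' b'
    assume h: "i \<in> T" "b \<in> {0..m}" "i' \<in> T" "b' \<in> {0..m}" "f (i, b) = f (i', b')"
    then have e: "x i - real b = x i' - real b'" by (simp add: f_def)
    have "i = i'"
    proof (rule ccontr)
      assume "i \<noteq> i'"
      then have "\<forall>d\<le>m. x i \<noteq> x i' + real d" "\<forall>d\<le>m. x i' \<noteq> x i + real d"
        using assms(2) h by (auto simp: generic_def)
      moreover have "b - b' \<le> m" "b' - b \<le> m" using h by auto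
      ultimately have "x i \<noteq> x i' + real (b - b')" "x i' \<noteq> x i + real (b' - b)" by blast+
      then show False using e by (cases "b \<le> b'") (auto simp: of_nat_diff)
    qed
    then show "i = i' \<and> b = b'" using e by simp
  qed
  have count: "card {p \<in> P. v < p} = card (shifts m T x v) + card {t \<in> T. v < x t}" for v
  proof -
    have "(i, b) \<in> {q \<in> T \<times> {0..m}. v < f q} \<longleftrightarrow>
        (i, b) \<in> shifts m T x v \<union> {t \<in> T. v < x t} \<times> {0}" for i b
      by (cases "b = 0") (auto simp: f_def shifts_def)
    then have "{q \<in> T \<times> {0..m}. v < f q} = shifts m T x v \<union> {t \<in> T. v < x t} \<times> {0}"
      by (simp only: set_eq_iff split_paired_All) simp
    moreover have "{p \<in> P. v < p} = f ` {q \<in> T \<times> {0..m}. v < f q}"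
      unfolding P_def by blast
    ultimately have "{p \<in> P. v < p} = f ` (shifts m T x v \<union> {t \<in> T. v < x t} \<times> {0})"
      by simp
    moreover have "inj_on f (shifts m T x v \<union> {t \<in> T. v < x t} \<times> {0})"
      by (rule inj_on_subset[OF inj]) (auto simp: shifts_def)
    ultimately have "card {p \<in> P. v < p} = card (shifts m T x v \<union> {t \<in> T. v < x t} \<times> {0})"
      by (simp add: card_image)
    also have "\<dots> = card (shifts m T x v) + card ({t \<in> T. v < x t} \<times> {0 :: nat})"
      using assms(1) finite_shifts by (intro card_Un_disjoint) (auto simp: shifts_def)
    finally show ?thesis by (simp add: card_cartesian_product)
  qed
  have "card P = card T * Suc m" unfolding P_def using inj by (simp add: card_image card_cartesian_product)
  then have "c + card T \<le> card P" using assms(3) by (simp add: algebra_simps)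
  moreover have "finite P" using assms(1) by (simp add: P_def)
  ultimately obtain v where v: "v \<notin> P" "card {p \<in> P. v < p} = c + card T"
    using ex_card_greater_eq by blast
  have ne: "x t \<noteq> v + real b" if "t \<in> T" "b \<le> m" for t b
  proof
    assume "x t = v + real b"
    then have "v = f (t, b)" by (simp add: f_def)
    then show False using v(1) that by (auto simp: P_def)
  qed
  \<comment> \<open>A height above \<open>x t\<close> would have at most \<open>c\<close> shifts and
    fewer than \<open>card T\<close> coordinates above it, against the total
    \<open>c + card T\<close>.\<close>
  have below: "v < x t" if t: "t \<in> T" for t
  proof (rule ccontr)
    assume "\<not> v < x t"
    then have "x t < v" using ne[OF t, of 0] by auto
    then have "card (shifts m T x v) \<le> card (shifts m T x (x t))"
      using assms(1) by (intro card_mono finite_shifts) (auto simp: shifts_def)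
    moreover have "t \<notin> {t \<in> T. v < x t}" using \<open>x t < v\<close> by simp
    then have "card {t \<in> T. v < x t} < card T"
      using t by (intro psubset_card_mono assms(1)) blast
    ultimately show False using v(2) count[of v] assms(4)[OF t] by linarith
  qed
  then have "{t \<in> T. v < x t} = T" by auto
  then have "card (shifts m T x v) = c" using v(2) count[of v] by simp
  then show thesis using that below ne by blast
qed

text \<open>Take the least index among the minimizers of \<open>f\<close>. The
  \<open>of_bool\<close> makes the inequality strict for smaller indices, as in
  \<open>point_label_later\<close>.\<close>

lemma ex_lex_min:
  fixes f :: "nat \<Rightarrow> nat"
  assumes "finite S" "S \<noteq> {}"
  obtains k where "k \<in> S" "\<And>l. l \<in> S \<Longrightarrow> l \<noteq> k \<Longrightarrow> f k + of_bool (l < k) \<le> f l"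
proof -
  define M where "M = {k \<in> S. f k = Min (f ` S)}"
  have "Min (f ` S) \<in> f ` S" using assms by simp
  then have "M \<noteq> {}" by (force simp: M_def)
  moreover have fM: "finite M" using assms by (simp add: M_def)
  ultimately have k: "Min M \<in> M" by simp
  have "f (Min M) + of_bool (l < Min M) \<le> f l" if "l \<in> S" "l \<noteq> Min M" for l
  proof (cases "l < Min M")
    case True
    then have "l \<notin> M" using fM by (meson Min_le not_le)
    then show ?thesis using that k assms True unfolding M_def
      by (simp add: Suc_le_eq order_less_le)
  next
    case False
    then show ?thesis using that k assms unfolding M_def by simp
  qed
  then show thesis using that[of "Min M"] k by (auto simp: M_def)
qed

text \<open>All elements of the admissible set above its largest element \<open>k\<close> outside
  \<open>T\<close> belong to \<open>T\<close>, so the bound at \<open>k\<close> survives when larger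
  elements are counted in \<open>T\<close>.\<close>

lemma small_label_outside:
  assumes "T \<subseteq> {1..n}" "card T < n"
    and "Suc (card T) \<le> card (center n ((int (Suc (card T)) - 1) * int m) a)"
  shows "\<exists>k\<in>{1..n} - T. a k \<le> 1 + m * card T + card {j \<in> T. k < j}"
proof -
  obtain X where X: "center_admissible n (int (card T) * int m) a X" "Suc (card T) \<le> card X"
    using assms(3) unfolding card_center_ge_iff by auto
  have fT: "finite T" using assms(1) finite_subset by blast
  have sub: "X \<subseteq> {1..n}" using X by (simp add: center_admissible_def)
  then have fin: "finite (X - T)" by (meson finite_Diff finite_atLeastAtMost finite_subset)
  have "X - T \<noteq> {}" using X(2) fT by (metis Diff_eq_empty_iff card_mono not_less_eq_eq)
  then have k: "Max (X - T) \<in> X - T" using fin Max_in by blast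
  define k where "k = Max (X - T)"
  have "j \<in> T" if "j \<in> X" "k < j" for j
    using that fin Max_ge[of "X - T" j] by (metis DiffI k_def not_le)
  then have "card {j \<in> X. k < j} \<le> card {j \<in> T. k < j}"
    using fT by (intro card_mono) auto
  moreover have "int (a k) \<le> int (card T) * int m + 1 + int (card {j \<in> X. k < j})"
    using X(1) k unfolding center_admissible_iff k_def by auto
  ultimately have "int (a k) \<le> int (1 + m * card T + card {j \<in> T. k < j})"
    by (simp add: mult.commute)
  then have "a k \<le> 1 + m * card T + card {j \<in> T. k < j}" by (simp only: of_nat_le_iff)
  then show ?thesis using k sub unfolding k_def by blast
qed

lemma ex_point_with_label:
  assumes pos: "\<And>k. k \<in> {1..n} \<Longrightarrow> 1 \<le> a k"
    and cat: "\<And>i. i \<in> {1..n} \<Longrightarrow> i \<le> card (center n ((int i - 1) * int m) a)"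
  shows "\<exists>x. generic m {1..n} x \<and> (\<forall>k\<in>{1..n}. point_label m {1..n} x k = a k)"
proof -
  \<comment> \<open>The last conjunct keeps the construction going: no remaining label asks for
    fewer shifts than a placed coordinate already has above it, so the next one fits below all of
    \<open>T\<close>.\<close>
  have "\<exists>T x. T \<subseteq> {1..n} \<and> card T = s \<and> generic m T x \<and>
      (\<forall>k\<in>T. point_label m T x k = a k) \<and>
      (\<forall>k\<in>{1..n} - T. \<forall>t\<in>T. 1 + card (shifts m T x (x t)) + card {j \<in> T. k < j} \<le> a k)"
    if "s \<le> n" for s
    using that
  proof (induction s)
    case 0
    show ?case by (rule exI[of _ "{}"]) (simp add: generic_def)
  next
    case (Suc s)
    then obtain T x where T: "T \<subseteq> {1..n}" "card T = s" "generic m T x"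
      and lab: "\<And>k. k \<in> T \<Longrightarrow> point_label m T x k = a k"
      and inv: "\<And>k t. k \<in> {1..n} - T \<Longrightarrow> t \<in> T \<Longrightarrow>
        1 + card (shifts m T x (x t)) + card {j \<in> T. k < j} \<le> a k"
      by (metis Suc_leD)
    have fT: "finite T" using T(1) finite_subset by blast
    define c where "c = (\<lambda>k. a k - 1 - card {j \<in> T. k < j})"
    \<comment> \<open>The subtractions in \<open>c\<close> do not truncate: for the first coordinate
      by positivity of the labels, later by the invariant.\<close>
    have ac: "a k = 1 + c k + card {j \<in> T. k < j}" if "k \<in> {1..n} - T" for k
    proof (cases "T = {}")
      case True
      then show ?thesis using pos[of k] that by (auto simp: c_def)
    next
      case False
      then obtain t where "t \<in> T" by blast
      from inv[OF that this] show ?thesis by (simp add: c_def)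
    qed
    have "{1..n} - T \<noteq> {}"
      using Suc.prems T fT by (metis Diff_eq_empty_iff card_mono card_atLeastAtMost diff_Suc_1 not_less_eq_eq)
    then obtain k where k: "k \<in> {1..n} - T"
      and kmin: "\<And>l. l \<in> {1..n} - T \<Longrightarrow> l \<noteq> k \<Longrightarrow> c k + of_bool (l < k) \<le> c l"
      using ex_lex_min[of "{1..n} - T" c] by auto
    \<comment> \<open>The index supplied by the center need not be \<open>k\<close>, but minimality
      carries its bound over to \<open>k\<close>.\<close>
    have "c k \<le> m * card T"
    proof -
      obtain l where l: "l \<in> {1..n} - T" "a l \<le> 1 + m * card T + card {j \<in> T. l < j}"
        using small_label_outside[OF T(1), of m a] cat[of "Suc s"] Suc.prems T(2) by auto
      then have "c l \<le> m * card T" using ac by simp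
      then show ?thesis using kmin[OF l(1)] by (cases "l = k") auto
    qed
    moreover have "card (shifts m T x (x t)) \<le> c k" if "t \<in> T" for t
      using inv[OF k that] ac[OF k] by simp
    ultimately obtain v where v: "\<And>t. t \<in> T \<Longrightarrow> v < x t"
      "\<And>t b. t \<in> T \<Longrightarrow> b \<le> m \<Longrightarrow> x t \<noteq> v + real b" "card (shifts m T x v) = c k"
      using ex_point_below[OF fT T(3)] by metis
    define y where "y = x(k := v)"
    have y: "y k = v" "\<And>t. t \<in> T \<Longrightarrow> y t = x t" using k by (auto simp: y_def)
    \<comment> \<open>A positive shift of \<open>v\<close> lies below every height
      \<open>w \<ge> v\<close>, so the new coordinate leaves the earlier counts unchanged.\<close>
    have sh: "shifts m (insert k T) y w = shifts m T x w" if "v \<le> w" for w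
      using that y unfolding shifts_def by auto
    have gen: "generic m (insert k T) y"
    proof -
      have "v \<noteq> x t + real b" if "t \<in> T" for t b using v(1)[OF that] by auto
      then show ?thesis using T(3) v(2) y unfolding generic_def by auto
    qed
    have lab_k: "point_label m (insert k T) y k = a k"
    proof -
      have "{j \<in> insert k T. k < j \<and> y k < y j} = {j \<in> T. k < j}" using y v(1) by auto
      then show ?thesis using sh[of v] v(3) ac[OF k] y by (simp add: point_label_def)
    qed
    have lab_t: "point_label m (insert k T) y t = a t" if t: "t \<in> T" for t
    proof -
      have "{j \<in> insert k T. t < j \<and> y t < y j} = {j \<in> T. t < j \<and> x t < x j}"
        using y v(1)[OF t] t by auto
      then show ?thesis using sh[of "x t"] v(1)[OF t] lab[OF t] y(2)[OF t]
        by (simp add: point_label_def)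
    qed
    \<comment> \<open>At most \<open>c k\<close> shifts lie above any placed coordinate; the extra
      larger index \<open>k\<close>, present exactly for \<open>l < k\<close>, is paid for by
      lexicographic minimality.\<close>
    have inv': "1 + card (shifts m (insert k T) y (y t)) + card {j \<in> insert k T. l < j} \<le> a l"
      if l: "l \<in> {1..n} - insert k T" and t: "t \<in> insert k T" for l t
    proof -
      have vt: "v \<le> y t" using t y v(1) by (auto intro: less_imp_le)
      then have "card (shifts m (insert k T) y (y t)) \<le> card (shifts m T x v)"
        unfolding sh[OF vt] using vt
        by (intro card_mono finite_shifts fT) (auto simp: shifts_def)
      moreover have "{j \<in> insert k T. l < j} = (if l < k then insert k {j \<in> T. l < j} else {j \<in> T. l < j})"
        by auto
      then have "card {j \<in> insert k T. l < j} = card {j \<in> T. l < j} + of_bool (l < k)"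
        using fT k by simp
      ultimately show ?thesis using v(3) ac[of l] kmin[of l] l by auto
    qed
    have "insert k T \<subseteq> {1..n}" "card (insert k T) = Suc s"
      using k T fT by auto
    then show ?case using gen lab_k lab_t inv'
      by (intro exI[of _ "insert k T"] exI[of _ y]) blast
  qed
  from this[of n] obtain T x where T: "T \<subseteq> {1..n}" "card T = n" "generic m T x"
      "\<forall>k\<in>T. point_label m T x k = a k" by auto
  then have "T = {1..n}" by (intro card_subset_eq) auto
  then show ?thesis using T by blast
qed

section \<open>Regions as sign classes\<close>

definition arrangement_complement :: "nat \<Rightarrow> nat \<Rightarrow> (nat \<Rightarrow> real) set" where
  "arrangement_complement n m = ({1..n} \<rightarrow>\<^sub>E UNIV) - (\<Union>H \<in> catalan_triples n m. hyperplane n H)"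

text \<open>This encodes the sign vector of \<open>x\<close>: off the hyperplanes the strictly
  negative sides determine all signs.\<close>

definition negative_sides :: "nat \<Rightarrow> nat \<Rightarrow> (nat \<Rightarrow> real) \<Rightarrow> (nat \<times> nat \<times> int) set" where
  "negative_sides n m x = {(i, j, a) \<in> catalan_triples n m. x i - x j < of_int a}"

definition region_of :: "nat \<Rightarrow> nat \<Rightarrow> (nat \<Rightarrow> real) \<Rightarrow> (nat \<Rightarrow> real) set" where
  "region_of n m x = {y \<in> arrangement_complement n m. negative_sides n m y = negative_sides n m x}"

lemma arrangement_complement_iff:
  "x \<in> arrangement_complement n m \<longleftrightarrow> x \<in> {1..n} \<rightarrow>\<^sub>E UNIV \<and>
     (\<forall>(i, j, a) \<in> catalan_triples n m. x i - x j \<noteq> of_int a)"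
  unfolding arrangement_complement_def hyperplane_def by auto

lemma finite_catalan_triples: "finite (catalan_triples n m)"
  by (rule finite_subset[of _ "{1..n} \<times> {1..n} \<times> {- int m..int m}"])
    (auto simp: catalan_triples_def)

text \<open>On a connected set avoiding a hyperplane, the continuous coordinate difference cannot
  cross \<open>a\<close>. Conversely, the segment between points with equal signs stays in the
  complement.\<close>

lemma connected_component_of_complement_iff:
  assumes "x \<in> arrangement_complement n m" "y \<in> arrangement_complement n m"
  shows "connected_component_of
      (subtopology (powertop_real {1..n}) (arrangement_complement n m)) x y \<longleftrightarrow>
    negative_sides n m x = negative_sides n m y" (is "connected_component_of ?X x y \<longleftrightarrow> _")
proof
  assume "connected_component_of ?X x y"
  then obtain S where S: "connectedin ?X S" "x \<in> S" "y \<in> S"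
    by (auto simp: connected_component_of_def)
  have "x i - x j < of_int a \<longleftrightarrow> y i - y j < of_int a" if H: "(i, j, a) \<in> catalan_triples n m" for i j a
  proof -
    have ij: "i \<in> {1..n}" "j \<in> {1..n}" using H by (auto simp: catalan_triples_def)
    have "continuous_map ?X euclideanreal (\<lambda>z. z i - z j)"
      using ij by (intro continuous_map_diff continuous_map_from_subtopology
          continuous_map_product_projection)
    then have con: "connected ((\<lambda>z. z i - z j) ` S)"
      using connectedin_continuous_map_image S(1) by fastforce
    have "S \<subseteq> arrangement_complement n m"
      using connectedin_subset_topspace[OF S(1)] by auto
    then have "of_int a \<notin> (\<lambda>z. z i - z j) ` S"
      using H by (fastforce simp: arrangement_complement_iff)
    then show ?thesis
      using con S(2,3) unfolding connected_iff_interval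
      by (smt (verit, best) image_eqI)
  qed
  then show "negative_sides n m x = negative_sides n m y"
    by (auto simp: negative_sides_def)
next
  assume eq: "negative_sides n m x = negative_sides n m y"
  define g where "g = (\<lambda>t::real. \<lambda>k\<in>{1..n}. (1 - t) * x k + t * y k)"
  have "g t \<in> arrangement_complement n m" if t: "t \<in> {0..1}" for t
    unfolding arrangement_complement_iff
  proof (intro conjI ballI, goal_cases)
    case 1
    show ?case by (auto simp: g_def)
  next
    case (2 H)
    obtain i j a where H: "H = (i, j, a)" by (metis surj_pair)
    then have ij: "i \<in> {1..n}" "j \<in> {1..n}" using 2 by (auto simp: catalan_triples_def)
    then have e: "g t i - g t j = (1 - t) * (x i - x j) + t * (y i - y j)"
      by (simp add: g_def algebra_simps)
    have ne: "x i - x j \<noteq> of_int a" "y i - y j \<noteq> of_int a"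
      using assms 2 H by (auto simp: arrangement_complement_iff)
    have "x i - x j < of_int a \<longleftrightarrow> y i - y j < of_int a"
      using eq 2 H unfolding negative_sides_def by blast
    \<comment> \<open>The positive case is written with negated differences so that
      \<open>convex_bound_lt\<close> serves both cases.\<close>
    then consider "x i - x j < of_int a" "y i - y j < of_int a"
      | "- (x i - x j) < - of_int a" "- (y i - y j) < - of_int a" using ne by linarith
    then show ?case
    proof cases
      case 1
      then have "(1 - t) * (x i - x j) + t * (y i - y j) < of_int a"
        using t by (intro convex_bound_lt) auto
      then show ?thesis using H e by simp
    next
      case 2
      then have "(1 - t) * (- (x i - x j)) + t * (- (y i - y j)) < - of_int a"
        using t by (intro convex_bound_lt) auto
      then have "g t i - g t j > of_int a" using e by (simp add: algebra_simps)
      then show ?thesis using H by simp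
    qed
  qed
  moreover have "continuous_map (top_of_set {0..1}) (powertop_real {1..n}) g"
    unfolding continuous_map_componentwise
    by (auto simp: g_def continuous_map_iff_continuous intro!: continuous_intros)
  ultimately have "continuous_map (top_of_set {0..1}) ?X g"
    by (auto simp: continuous_map_in_subtopology)
  moreover have "connectedin (top_of_set {0..1::real}) {0..1}"
    by (simp add: connectedin_subtopology)
  ultimately have "connectedin ?X (g ` {0..1})"
    using connectedin_continuous_map_image by blast
  moreover have "g 0 = x" "g 1 = y"
    using assms by (auto simp: g_def arrangement_complement_iff PiE_def extensional_restrict)
  then have "x \<in> g ` {0..1}" "y \<in> g ` {0..1}"
    by (metis atLeastAtMost_iff image_eqI order_refl zero_le_one)+
  ultimately show "connected_component_of ?X x y"
    unfolding connected_component_of_def by blast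
qed

lemma catalan_regions_eq:
  "catalan_regions n m = region_of n m ` arrangement_complement n m"
proof -
  let ?X = "subtopology (powertop_real {1..n}) (arrangement_complement n m)"
  have top: "topspace ?X = arrangement_complement n m"
    by (auto simp: arrangement_complement_def)
  have "connected_component_of_set ?X x = region_of n m x" if "x \<in> arrangement_complement n m" for x
    using connected_component_of_complement_iff[OF that] connected_component_in_topspace[of ?X x] top
    unfolding region_of_def by (auto dest: connected_component_in_topspace)
  then show ?thesis
    unfolding catalan_regions_def connected_components_of_def
      arrangement_complement_def[symmetric] top by simp
qed

text \<open>On the defining set all differences \<open>x i - x j\<close> with \<open>i < j\<close>
  lie strictly between 0 and 1, which fixes every sign. A region is determined by any of its points,
  which gives uniqueness for \<open>THE\<close>.\<close>

lemma base_region_eq: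
  assumes "n \<ge> 1"
  obtains z where "z \<in> arrangement_complement n m" "base_region n m = region_of n m z"
    "negative_sides n m z = {(i, j, a) \<in> catalan_triples n m. 0 < a}"
proof -
  define B where "B = {x \<in> {1..n} \<rightarrow>\<^sub>E (UNIV :: real set). strict_antimono_on {1..n} x \<and> x 1 - x n < 1}"
  have BC: "z \<in> arrangement_complement n m"
    and Bneg: "negative_sides n m z = {(i, j, a) \<in> catalan_triples n m. 0 < a}" if z: "z \<in> B" for z
  proof -
    have *: "0 < z i - z j" "z i - z j < 1" if "(i, j, a) \<in> catalan_triples n m" for i j a
    proof -
      have ij: "1 \<le> i" "i < j" "j \<le> n" using that by (auto simp: catalan_triples_def)
      have mono: "z l < z k" if "1 \<le> k" "k < l" "l \<le> n" for k l
        using z that unfolding B_def monotone_on_def by auto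
      show "0 < z i - z j" using mono ij by simp
      have "z i \<le> z 1" "z n \<le> z j" using mono[of 1 i] mono[of j n] ij by (force simp: order_le_less)+
      then show "z i - z j < 1" using z by (simp add: B_def)
    qed
    have **: "z i - z j \<noteq> of_int a \<and> (z i - z j < of_int a \<longleftrightarrow> 0 < a)"
      if "(i, j, a) \<in> catalan_triples n m" for i j a
    proof (cases "0 < a")
      case True
      then have "(1::real) \<le> of_int a" by simp
      then show ?thesis using *[OF that] True by linarith
    next
      case False
      then have "of_int a \<le> (0::real)" by simp
      then show ?thesis using *[OF that] False by linarith
    qed
    show "z \<in> arrangement_complement n m"
      using ** z unfolding arrangement_complement_iff B_def by auto
    show "negative_sides n m z = {(i, j, a) \<in> catalan_triples n m. 0 < a}"
      using ** unfolding negative_sides_def by auto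
  qed
  \<comment> \<open>Spacing \<open>1 / n\<close> keeps the total spread \<open>(n - 1) / n\<close>
    below 1.\<close>
  define z where "z = (\<lambda>k\<in>{1..n}. - real k / real n)"
  have z: "z \<in> B"
    using assms unfolding B_def z_def monotone_on_def by (auto simp: field_simps)
  have "base_region n m = region_of n m z"
    unfolding base_region_def B_def[symmetric]
  proof (rule the_equality)
    have "region_of n m z \<in> catalan_regions n m"
      using BC[OF z] unfolding catalan_regions_eq by blast
    moreover have "B \<subseteq> region_of n m z"
      using BC Bneg Bneg[OF z] by (simp add: region_of_def subset_iff)
    ultimately show "region_of n m z \<in> catalan_regions n m \<and> B \<subseteq> region_of n m z" ..
    show "R = region_of n m z" if "R \<in> catalan_regions n m \<and> B \<subseteq> R" for R
    proof -
      obtain w where "R = region_of n m w" using \<open>R \<in> catalan_regions n m \<and> B \<subseteq> R\<close>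
        unfolding catalan_regions_eq by blast
      moreover have "z \<in> R" using that z by blast
      ultimately show ?thesis by (simp add: region_of_def)
    qed
  qed
  then show thesis using that BC Bneg z by blast
qed

section \<open>Separation from the base region and labels of regions\<close>

lemma separates_base_region_iff:
  assumes "n \<ge> 1" "x \<in> arrangement_complement n m" "(i, j, a) \<in> catalan_triples n m"
  shows "separates (i, j, a) (region_of n m x) (base_region n m) \<longleftrightarrow>
    (if 0 < a then of_int a < x i - x j else x i - x j < of_int a)"
proof -
  obtain z where z: "z \<in> arrangement_complement n m" "base_region n m = region_of n m z"
    "negative_sides n m z = {(i, j, a) \<in> catalan_triples n m. 0 < a}"
    by (rule base_region_eq[OF assms(1)])
  \<comment> \<open>A region has constant signs and contains \<open>w\<close>, so exactly one of the
    two inclusions holds.\<close>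
  have side: "region_of n m w \<subseteq> {y. y i - y j < of_int a} \<longleftrightarrow> (i, j, a) \<in> negative_sides n m w"
    "region_of n m w \<subseteq> {y. y i - y j > of_int a} \<longleftrightarrow> (i, j, a) \<notin> negative_sides n m w"
    if w: "w \<in> arrangement_complement n m" for w
  proof -
    have neg: "y i - y j < of_int a \<longleftrightarrow> (i, j, a) \<in> negative_sides n m w"
      "y i - y j \<noteq> of_int a" if "y \<in> region_of n m w" for y
    proof -
      have y: "y \<in> arrangement_complement n m" "negative_sides n m w = negative_sides n m y"
        using that by (simp_all add: region_of_def)
      show "y i - y j < of_int a \<longleftrightarrow> (i, j, a) \<in> negative_sides n m w"
        unfolding y(2) using assms(3) by (simp add: negative_sides_def)
      show "y i - y j \<noteq> of_int a"
        using y(1) assms(3) by (auto simp: arrangement_complement_iff)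
    qed
    have self: "w \<in> region_of n m w" using w by (simp add: region_of_def)
    show "region_of n m w \<subseteq> {y. y i - y j < of_int a} \<longleftrightarrow> (i, j, a) \<in> negative_sides n m w"
      using neg self by blast
    show "region_of n m w \<subseteq> {y. y i - y j > of_int a} \<longleftrightarrow> (i, j, a) \<notin> negative_sides n m w"
      using neg self by (smt (verit) mem_Collect_eq subset_iff)
  qed
  have "(i, j, a) \<in> negative_sides n m z \<longleftrightarrow> 0 < a" using z(3) assms(3) by auto
  moreover have "(i, j, a) \<in> negative_sides n m x \<longleftrightarrow> x i - x j < of_int a"
    using assms(3) by (simp add: negative_sides_def)
  moreover have "x i - x j \<noteq> of_int a" using assms(2,3) by (auto simp: arrangement_complement_iff)
  ultimately show ?thesis
    using side[OF assms(2)] side[OF z(1)] unfolding separates_def z(2) by auto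
qed

text \<open>The separating hyperplanes charged to \<open>k\<close> are in bijection with the pairs
  counted by \<open>point_label\<close>; \<open>b = 0\<close> stands for the inversions.\<close>

lemma pak_stanley_label_eq:
  assumes "n \<ge> 1" "x \<in> arrangement_complement n m" "k \<in> {1..n}"
  shows "pak_stanley_label n m (region_of n m x) k = point_label m {1..n} x k"
proof -
  let ?S = "{H \<in> catalan_triples n m. separates H (region_of n m x) (base_region n m)}"
  let ?A = "{H \<in> ?S. k = hyperplane_coord H}"
  let ?B = "shifts m {1..n} x (x k) \<union> {j \<in> {1..n}. k < j \<and> x k < x j} \<times> {0}"
  \<comment> \<open>\<open>?f\<close> keeps the index other than \<open>k\<close> and the absolute
    value of \<open>a\<close>. \<open>?g\<close> recovers the sign of \<open>a\<close> from the
    order of \<open>j\<close> and \<open>k\<close>; at \<open>b = 0\<close> only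
    \<open>j > k\<close> occurs.\<close>
  let ?f = "\<lambda>(i::nat, j::nat, a::int). if 0 < a then (i, nat a) else (j, nat (- a))"
  let ?g = "\<lambda>(j::nat, b::nat). if j < k then (j, k, int b) else (k, j, - int b)"
  have A: "(i, j, a) \<in> ?A \<longleftrightarrow> (i, j, a) \<in> catalan_triples n m \<and>
      (if 0 < a then j = k \<and> of_int a < x i - x j else i = k \<and> x i - x j < of_int a)" for i j a
    using separates_base_region_iff[OF assms(1,2), of i j a]
    by (auto simp: hyperplane_coord_def)
  have "bij_betw ?f ?A ?B"
  proof (rule bij_betw_byWitness[where f' = ?g])
    show "\<forall>H\<in>?A. ?g (?f H) = H"
    proof
      fix H assume H: "H \<in> ?A"
      obtain i j a where e: "H = (i, j, a)" by (metis surj_pair)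
      show "?g (?f H) = H" using H unfolding e A by (auto simp: catalan_triples_def split: if_splits)
    qed
    show "\<forall>p\<in>?B. ?f (?g p) = p" by (auto simp: shifts_def)
    show "?f ` ?A \<subseteq> ?B"
    proof (rule image_subsetI)
      fix H assume H: "H \<in> ?A"
      obtain i j a where e: "H = (i, j, a)" by (metis surj_pair)
      show "?f H \<in> ?B"
      proof (cases "0 < a")
        case True
        then show ?thesis using H unfolding e A by (auto simp: catalan_triples_def shifts_def)
      next
        case False
        define b where "b = nat (- a)"
        then have a: "a = - int b" using False by simp
        show ?thesis using H unfolding e A a
          by (cases "b = 0") (auto simp: catalan_triples_def shifts_def)
      qed
    qed
    show "?g ` ?B \<subseteq> ?A"
    proof (rule image_subsetI)
      fix p assume p: "p \<in> ?B"
      obtain j b where e: "p = (j, b)" by (metis surj_pair)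
      have "j \<noteq> k" using p e by (auto simp: shifts_def)
      then consider "j < k" | "k < j" by linarith
      then show "?g p \<in> ?A"
      proof cases
        case 1
        then have "?g p = (j, k, int b)" by (simp add: e)
        then show ?thesis using p 1 assms(3) unfolding e
          by (simp only: A) (auto simp: catalan_triples_def shifts_def)
      next
        case 2
        then have "?g p = (k, j, - int b)" by (simp add: e)
        then show ?thesis using p 2 assms(3) unfolding e
          by (simp only: A) (auto simp: catalan_triples_def shifts_def)
      qed
    qed
  qed
  then have "card ?A = card ?B" by (rule bij_betw_same_card)
  also have "\<dots> = card (shifts m {1..n} x (x k)) + card ({j \<in> {1..n}. k < j \<and> x k < x j} \<times> {0 :: nat})"
    by (intro card_Un_disjoint finite_shifts) (auto simp: shifts_def)
  finally have "card ?A = card (shifts m {1..n} x (x k)) + card {j \<in> {1..n}. k < j \<and> x k < x j}"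
    by (simp add: card_cartesian_product)
  moreover have "(\<Sum>H\<in>?S. of_bool (k = hyperplane_coord H)) = card ?A"
    using finite_catalan_triples[of n m] by (simp add: Int_def)
  ultimately show ?thesis
    using assms(3) by (simp add: pak_stanley_label_def point_label_def)
qed

text \<open>A triple is an unordered pair with a signed offset, whereas \<open>generic\<close> takes
  ordered pairs and nonnegative shifts; exchanging the indices translates between them.\<close>

lemma arrangement_complement_generic:
  assumes "x \<in> {1..n} \<rightarrow>\<^sub>E UNIV"
  shows "x \<in> arrangement_complement n m \<longleftrightarrow> generic m {1..n} x"
proof
  assume x: "x \<in> arrangement_complement n m"
  show "generic m {1..n} x"
    unfolding generic_def
  proof (intro ballI impI allI)
    fix i j b assume h: "i \<in> {1..n}" "j \<in> {1..n}" "i \<noteq> j" "b \<le> m"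
    then have "(if i < j then (i, j, int b) else (j, i, - int b)) \<in> catalan_triples n m"
      by (auto simp: catalan_triples_def)
    then show "x i \<noteq> x j + real b"
      using x by (fastforce simp: arrangement_complement_iff split: if_splits)
  qed
next
  assume x: "generic m {1..n} x"
  have "x i - x j \<noteq> of_int a" if H: "(i, j, a) \<in> catalan_triples n m" for i j a
  proof -
    have "i \<in> {1..n}" "j \<in> {1..n}" "i \<noteq> j" "nat \<bar>a\<bar> \<le> m"
      using H by (auto simp: catalan_triples_def)
    then have "x i \<noteq> x j + real (nat \<bar>a\<bar>)" "x j \<noteq> x i + real (nat \<bar>a\<bar>)"
      using x[unfolded generic_def, rule_format, of i j "nat \<bar>a\<bar>"]
        x[unfolded generic_def, rule_format, of j i "nat \<bar>a\<bar>"] by auto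
    then show ?thesis by (cases "0 \<le> a") auto
  qed
  then show "x \<in> arrangement_complement n m"
    using assms by (auto simp: arrangement_complement_iff)
qed

text \<open>For \<open>0 \<le> a\<close>, genericity excludes equality, so
  \<open>x i - x j < a\<close> negates a comparison in \<open>same_order\<close>; for negative
  \<open>a\<close> it is a comparison of the exchanged pair.\<close>

lemma same_order_negative_sides:
  assumes "generic m {1..n} x" "generic m {1..n} y" "same_order m {1..n} x y"
  shows "negative_sides n m x = negative_sides n m y"
proof -
  have "x i - x j < of_int a \<longleftrightarrow> y i - y j < of_int a" if H: "(i, j, a) \<in> catalan_triples n m" for i j a
  proof -
    have ij: "i \<in> {1..n}" "j \<in> {1..n}" "i \<noteq> j" "nat \<bar>a\<bar> \<le> m"
      using H by (auto simp: catalan_triples_def)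
    have "x i \<noteq> x j + real (nat \<bar>a\<bar>)" "y i \<noteq> y j + real (nat \<bar>a\<bar>)"
      using assms(1,2)[unfolded generic_def, rule_format, of i j "nat \<bar>a\<bar>"] ij by auto
    moreover have "x j + real (nat \<bar>a\<bar>) < x i \<longleftrightarrow> y j + real (nat \<bar>a\<bar>) < y i"
      "x i + real (nat \<bar>a\<bar>) < x j \<longleftrightarrow> y i + real (nat \<bar>a\<bar>) < y j"
      using assms(3)[unfolded same_order_def, rule_format, of i j "nat \<bar>a\<bar>"]
        assms(3)[unfolded same_order_def, rule_format, of j i "nat \<bar>a\<bar>"] ij by auto
    ultimately show ?thesis by (cases "0 \<le> a") auto
  qed
  then show ?thesis by (auto simp: negative_sides_def)
qed

theorem mainTheorem5:
  fixes n m :: nat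
  assumes "n \<ge> 1" and "m \<ge> 1"
  shows "pak_stanley_label n m ` catalan_regions n m = catalan_functions n m \<and>
    bij_betw (pak_stanley_label n m) (catalan_regions n m) (catalan_functions n m)"
proof -
  let ?C = "arrangement_complement n m" and ?l = "pak_stanley_label n m"
  note label = pak_stanley_label_eq[OF assms(1)]
  have gen: "generic m {1..n} x" if "x \<in> ?C" for x
    using that arrangement_complement_generic[of x n m] by (simp add: arrangement_complement_iff)
  have "?l (region_of n m x) \<in> catalan_functions n m" if x: "x \<in> ?C" for x
  proof -
    have "?l (region_of n m x) \<in> {1..n} \<rightarrow>\<^sub>E {1..}" by (auto simp: pak_stanley_label_def)
    moreover have "i \<le> card (center n ((int i - 1) * int m) (?l (region_of n m x)))"
      if "i \<in> {1..n}" for i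
      using point_label_admissible[OF gen[OF x] that] label[OF x] by blast
    ultimately show ?thesis by (simp add: catalan_functions_def)
  qed
  moreover have "a \<in> ?l ` catalan_regions n m" if a: "a \<in> catalan_functions n m" for a
  proof -
    have ext: "a \<in> {1..n} \<rightarrow>\<^sub>E {1..}" using a by (simp add: catalan_functions_def)
    then have "\<And>k. k \<in> {1..n} \<Longrightarrow> 1 \<le> a k" by auto
    then obtain w where w: "generic m {1..n} w" "\<forall>k\<in>{1..n}. point_label m {1..n} w k = a k"
      using ex_point_with_label[of n a m] a by (auto simp: catalan_functions_def)
    \<comment> \<open>Restriction makes the point extensional; its labels involve only the
      coordinates in \<open>{1..n}\<close>.\<close>
    define x where "x = restrict w {1..n}"
    have "generic m {1..n} x" using w(1) by (simp add: generic_def x_def)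
    then have x: "x \<in> ?C" using arrangement_complement_generic[of x n m] by (simp add: x_def)
    have "point_label m {1..n} x k = point_label m {1..n} w k" if "k \<in> {1..n}" for k
    proof -
      have "shifts m {1..n} x (x k) = shifts m {1..n} w (w k)"
        using that by (auto simp: shifts_def x_def)
      moreover have "{j \<in> {1..n}. k < j \<and> x k < x j} = {j \<in> {1..n}. k < j \<and> w k < w j}"
        using that by (auto simp: x_def)
      ultimately show ?thesis by (simp add: point_label_def)
    qed
    then have "?l (region_of n m x) k = a k" if "k \<in> {1..n}" for k
      using label[OF x that] w(2) that by simp
    then have "?l (region_of n m x) = a"
      using ext by (intro PiE_ext[of _ "{1..n}" "\<lambda>_. UNIV"]) (auto simp: pak_stanley_label_def)
    then show ?thesis using x unfolding catalan_regions_eq by blast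
  qed
  ultimately have img: "?l ` catalan_regions n m = catalan_functions n m"
    unfolding catalan_regions_eq by blast
  have "inj_on ?l (catalan_regions n m)"
  proof (rule inj_onI, unfold catalan_regions_eq, clarify)
    fix x y assume xy: "x \<in> ?C" "y \<in> ?C" "?l (region_of n m x) = ?l (region_of n m y)"
    then have "point_label m {1..n} x k = point_label m {1..n} y k" if "k \<in> {1..n}" for k
      using label[OF _ that] by metis
    then have "same_order m {1..n} x y"
      using point_label_inj[of "{1..n}" m x y] gen xy by blast
    then show "region_of n m x = region_of n m y"
      using same_order_negative_sides gen xy unfolding region_of_def by metis
  qed
  then show ?thesis using img by (simp add: bij_betw_def)
qed

end
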